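(* Let $E$ be a Banach lattice and $T:E\to E$ an operator. If $T$ is both uo-demi Dunford–Pettis and $\sigma$-weak-uo continuous, then $\alpha T$ is uo-demi Dunford–Pettis for all $\alpha\in\mathbb{R}$.
   Context: All Banach lattices are real; "operator" means bounded linear map. A net $(x_\alpha)$ in a Banach lattice $E$ is uo-convergent (unbounded order convergent) to $x$, written $x_\alpha\xrightarrow{uo}x$, if $|x_\alpha-x|\wedge y$ converges in order to $0$ for every $y\in E^+$. An operator $T:E\to E$ on a Banach lattice $E$ is uo-demi Dunford–Pettis (unbounded order demi Dunford–Pettis) if for every weakly null sequence $(x_n)$ in $E$ such that $(x_n-T(x_n))$ is uo-convergent to $0$, one has $\|x_n\|\to0$. An operator $T:E\to E$ is $\sigma$-weak-uo continuous if $T(x_n)\xrightarrow{uo}0$ in $E$ for every weakly null sequence $(x_n)$ in $E$. *)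

theory Defs
  imports "HOL-Analysis.Analysis" "HOL-Library.Lattice_Algebras"
begin

class banach_lattice = banach + lattice_ab_group_add_abs + ordered_real_vector +
  assumes norm_lattice: "\<bar>x\<bar> \<le> \<bar>y\<bar> \<Longrightarrow> norm x \<le> norm y"

instance real :: banach_lattice
  by intro_classes simp

(* Order convergence of (x i) to l along F: some decreasing net (y b) with infimum 0 satisfies,
   for every b, |x i - l| \<le> y b for all i far enough along F.  A decreasing net is represented
   by its range D, a nonempty downward directed set; this avoids quantifying over index types
   (see the two lemmas below).  A net (x i) is given with its tail filter F. *)
definition order_convergent ::
    "('i \<Rightarrow> 'a::banach_lattice) \<Rightarrow> 'a \<Rightarrow> 'i filter \<Rightarrow> bool" where
  "order_convergent x l F \<longleftrightarrow>
     (\<exists>D. D \<noteq> {} \<and>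
          (\<forall>a\<in>D. \<forall>b\<in>D. \<exists>c\<in>D. c \<le> a \<and> c \<le> b) \<and>
          (\<forall>d\<in>D. 0 \<le> d) \<and> (\<forall>z. (\<forall>d\<in>D. z \<le> d) \<longrightarrow> z \<le> 0) \<and>
          (\<forall>d\<in>D. \<forall>\<^sub>F i in F. \<bar>x i - l\<bar> \<le> d))"

definition decreasing_net_to_0 ::
    "'b set \<Rightarrow> ('b \<Rightarrow> 'b \<Rightarrow> bool) \<Rightarrow> ('b \<Rightarrow> 'a::banach_lattice) \<Rightarrow> bool" where
  "decreasing_net_to_0 B le y \<longleftrightarrow>
     B \<noteq> {} \<and> (\<forall>b\<in>B. le b b) \<and>
     (\<forall>b\<in>B. \<forall>c\<in>B. \<forall>d\<in>B. le b c \<longrightarrow> le c d \<longrightarrow> le b d) \<and>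
     (\<forall>b\<in>B. \<forall>c\<in>B. \<exists>d\<in>B. le b d \<and> le c d) \<and>
     (\<forall>b\<in>B. \<forall>c\<in>B. le b c \<longrightarrow> y c \<le> y b) \<and>
     (\<forall>b\<in>B. 0 \<le> y b) \<and> (\<forall>z. (\<forall>b\<in>B. z \<le> y b) \<longrightarrow> z \<le> 0)"

lemma order_convergent_if_net:
  assumes net: "decreasing_net_to_0 B le y"
    and ev: "\<forall>b\<in>B. \<forall>\<^sub>F i in F. \<bar>x i - l\<bar> \<le> y b"
  shows "order_convergent x l F"
proof -
  have ne: "B \<noteq> {}"
    and up: "\<forall>b\<in>B. \<forall>c\<in>B. \<exists>d\<in>B. le b d \<and> le c d"
    and mono: "\<forall>b\<in>B. \<forall>c\<in>B. le b c \<longrightarrow> y c \<le> y b"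
    and lower: "\<forall>b\<in>B. 0 \<le> y b"
    and inf0: "\<forall>z. (\<forall>b\<in>B. z \<le> y b) \<longrightarrow> z \<le> 0"
    using net unfolding decreasing_net_to_0_def by - (elim conjE, assumption)+
  have "\<exists>c\<in>y ` B. c \<le> y a \<and> c \<le> y b" if "a \<in> B" "b \<in> B" for a b
  proof -
    obtain d where "d \<in> B" "le a d" "le b d"
      using bspec[OF bspec[OF up \<open>a \<in> B\<close>] \<open>b \<in> B\<close>] by (elim bexE conjE)
    with that mono have "y d \<le> y a" "y d \<le> y b" by simp_all
    with \<open>d \<in> B\<close> show ?thesis by (intro bexI[of _ "y d"] conjI imageI)
  qed
  then have dir: "\<forall>a\<in>y ` B. \<forall>b\<in>y ` B. \<exists>c\<in>y ` B. c \<le> a \<and> c \<le> b"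
    by (intro ballI) (elim imageE, simp only:)
  show ?thesis
    unfolding order_convergent_def
  proof (intro exI[of _ "y ` B"] conjI)
    show "y ` B \<noteq> {}" using ne by (simp only: image_is_empty not_False_eq_True)
    show "\<forall>d\<in>y ` B. 0 \<le> d" using lower by (simp only: ball_simps)
    show "\<forall>z. (\<forall>d\<in>y ` B. z \<le> d) \<longrightarrow> z \<le> 0" using inf0 by (simp only: ball_simps)
    show "\<forall>d\<in>y ` B. \<forall>\<^sub>F i in F. \<bar>x i - l\<bar> \<le> d" using ev by (simp only: ball_simps)
  qed (fact dir)
qed

lemma net_if_order_convergent:
  fixes x :: "'i \<Rightarrow> 'a::banach_lattice"
  assumes "order_convergent x l F"
  shows "\<exists>(B :: 'a set) le y. decreasing_net_to_0 B le y \<and>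
           (\<forall>b\<in>B. \<forall>\<^sub>F i in F. \<bar>x i - l\<bar> \<le> y b)"
proof -
  obtain D where D: "D \<noteq> {}" "\<forall>a\<in>D. \<forall>b\<in>D. \<exists>c\<in>D. c \<le> a \<and> c \<le> b"
    "\<forall>d\<in>D. 0 \<le> d" "\<forall>z. (\<forall>d\<in>D. z \<le> d) \<longrightarrow> z \<le> 0"
    "\<forall>d\<in>D. \<forall>\<^sub>F i in F. \<bar>x i - l\<bar> \<le> d"
    using assms unfolding order_convergent_def by (elim exE conjE)
  have "decreasing_net_to_0 D (\<ge>) (\<lambda>d. d)"
    unfolding decreasing_net_to_0_def
  proof (intro conjI)
    show "\<forall>b\<in>D. b \<le> b" by (intro ballI order_refl)
    show "\<forall>b\<in>D. \<forall>c\<in>D. \<forall>d\<in>D. c \<le> b \<longrightarrow> d \<le> c \<longrightarrow> d \<le> b"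
      by (intro ballI impI) (erule (1) order_trans[rotated])
    show "\<forall>b\<in>D. \<forall>c\<in>D. c \<le> b \<longrightarrow> c \<le> b" by (intro ballI impI)
  qed (fact D)+
  with D(5) show ?thesis by (intro exI conjI)
qed

definition uo_convergent ::
    "('i \<Rightarrow> 'a::banach_lattice) \<Rightarrow> 'a \<Rightarrow> 'i filter \<Rightarrow> bool" where
  "uo_convergent x l F \<longleftrightarrow> (\<forall>y\<ge>0. order_convergent (\<lambda>i. inf \<bar>x i - l\<bar> y) 0 F)"

definition weakly_null :: "(nat \<Rightarrow> 'a::real_normed_vector) \<Rightarrow> bool" where
  "weakly_null x \<longleftrightarrow> (\<forall>f :: 'a \<Rightarrow>\<^sub>L real. (\<lambda>n. blinfun_apply f (x n)) \<longlonglongrightarrow> 0)"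

definition uo_demi_Dunford_Pettis :: "('a::banach_lattice \<Rightarrow>\<^sub>L 'a) \<Rightarrow> bool" where
  "uo_demi_Dunford_Pettis T \<longleftrightarrow>
     (\<forall>x. weakly_null x \<longrightarrow> uo_convergent (\<lambda>n. x n - blinfun_apply T (x n)) 0 sequentially \<longrightarrow>
          (\<lambda>n. norm (x n)) \<longlonglongrightarrow> 0)"

definition sigma_weak_uo_continuous :: "('a::banach_lattice \<Rightarrow>\<^sub>L 'a) \<Rightarrow> bool" where
  "sigma_weak_uo_continuous T \<longleftrightarrow>
     (\<forall>x. weakly_null x \<longrightarrow> uo_convergent (\<lambda>n. blinfun_apply T (x n)) 0 sequentially)"

end

theory Submission
  imports Defs
begin

text \<open>For a weakly null sequence x, write x_n - T x_n = (x_n - \<alpha> T x_n) + T((\<alpha> -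
  1) x_n). If the first summand is uo-null, so is the whole: (\<alpha> - 1) x_n is again weakly
  null, hence its image under T is uo-null by sigma-weak-uo continuity. The uo-demi Dunford-Pettis
  property of T itself then gives norm convergence to 0. The lattice work is additivity of
  uo-convergence, \<open>uo_convergent_add\<close>, which rests on additivity of order convergence
  and on the subadditivity of truncation, \<open>inf_add_le\<close>.\<close>

lemma order_convergent_add:
  assumes "order_convergent x l F" and "order_convergent y m F"
  shows "order_convergent (\<lambda>i. x i + y i) (l + m) F"
proof -
  obtain D where D: "D \<noteq> {}" "\<forall>a\<in>D. \<forall>b\<in>D. \<exists>c\<in>D. c \<le> a \<and> c \<le> b"
    "\<forall>d\<in>D. 0 \<le> d" "\<forall>z. (\<forall>d\<in>D. z \<le> d) \<longrightarrow> z \<le> 0"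
    "\<forall>d\<in>D. \<forall>\<^sub>F i in F. \<bar>x i - l\<bar> \<le> d"
    using assms(1) unfolding order_convergent_def by (elim exE conjE)
  obtain E where E: "E \<noteq> {}" "\<forall>a\<in>E. \<forall>b\<in>E. \<exists>c\<in>E. c \<le> a \<and> c \<le> b"
    "\<forall>d\<in>E. 0 \<le> d" "\<forall>z. (\<forall>d\<in>E. z \<le> d) \<longrightarrow> z \<le> 0"
    "\<forall>d\<in>E. \<forall>\<^sub>F i in F. \<bar>y i - m\<bar> \<le> d"
    using assms(2) unfolding order_convergent_def by (elim exE conjE)
  \<comment> \<open>The Minkowski sum of the two dominating sets: it inherits downward directedness,
    and it dominates the sum by the triangle inequality.\<close>
  define S where "S = (\<lambda>(d, e). d + e) ` (D \<times> E)"
  have S_iff: "s \<in> S \<longleftrightarrow> (\<exists>d\<in>D. \<exists>e\<in>E. s = d + e)" for s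
    unfolding S_def by auto
  have "\<exists>c\<in>S. c \<le> a \<and> c \<le> b" if "a \<in> S" "b \<in> S" for a b
  proof -
    from that obtain d e d' e' where *: "d \<in> D" "e \<in> E" "a = d + e" "d' \<in> D" "e' \<in> E" "b = d' + e'"
      unfolding S_iff by blast
    obtain d'' where "d'' \<in> D" "d'' \<le> d" "d'' \<le> d'" using D(2) * by blast
    moreover obtain e'' where "e'' \<in> E" "e'' \<le> e" "e'' \<le> e'" using E(2) * by blast
    ultimately show ?thesis
      using * by (intro bexI[of _ "d'' + e''"]) (auto simp: S_iff intro: add_mono)
  qed
  moreover have "z \<le> 0" if z: "\<forall>s\<in>S. z \<le> s" for z
  proof -
    \<comment> \<open>The infimum of \<open>S\<close> is found one summand at a time: for fixed
      \<open>e\<close>, the element \<open>z - e\<close> is a lower bound of \<open>D\<close>, so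
      \<open>z \<le> e\<close>; thus \<open>z\<close> is a lower bound of \<open>E\<close>.\<close>
    have "z - e \<le> d" if "d \<in> D" "e \<in> E" for d e
    proof -
      have "d + e \<in> S" using that S_iff by blast
      with z show ?thesis by (simp add: diff_le_eq)
    qed
    then have "z - e \<le> 0" if "e \<in> E" for e
      using D(4) that by blast
    then show ?thesis using E(4) by simp
  qed
  moreover have "\<forall>\<^sub>F i in F. \<bar>x i + y i - (l + m)\<bar> \<le> s" if "s \<in> S" for s
  proof -
    obtain d e where de: "d \<in> D" "e \<in> E" "s = d + e"
      using \<open>s \<in> S\<close> unfolding S_iff by blast
    with D(5) E(5) have "\<forall>\<^sub>F i in F. \<bar>x i - l\<bar> \<le> d" "\<forall>\<^sub>F i in F. \<bar>y i - m\<bar> \<le> e"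
      by blast+
    then show ?thesis
    proof eventually_elim
      case (elim i)
      have "\<bar>x i + y i - (l + m)\<bar> \<le> \<bar>x i - l\<bar> + \<bar>y i - m\<bar>"
        by (rule abs_diff_triangle_ineq)
      also have "\<dots> \<le> s" using elim de(3) by (simp add: add_mono)
      finally show ?case .
    qed
  qed
  moreover have "S \<noteq> {}" using D(1) E(1) unfolding S_def by auto
  moreover have "\<forall>s\<in>S. 0 \<le> s" using D(3) E(3) by (auto simp: S_iff)
  ultimately show ?thesis
    unfolding order_convergent_def by (intro exI[of _ S] conjI ballI allI impI) simp_all
qed

text \<open>Any set that dominates \<open>y\<close> also dominates \<open>x\<close>, so the same
  witness serves.\<close>

lemma order_convergent_0_le:
  assumes "order_convergent y 0 F" and "\<And>i. \<bar>x i\<bar> \<le> \<bar>y i\<bar>"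
  shows "order_convergent x 0 F"
proof -
  have "\<forall>\<^sub>F i in F. \<bar>x i - 0\<bar> \<le> d" if "\<forall>\<^sub>F i in F. \<bar>y i - 0\<bar> \<le> d" for d
    using that by eventually_elim (simp add: order_trans[OF assms(2)])
  with assms(1) show ?thesis
    unfolding order_convergent_def by (elim ex_forward conj_forward) simp_all
qed

lemma inf_add_le:
  fixes a b y :: "'a::lattice_ab_group_add"
  assumes "0 \<le> a" "0 \<le> b" "0 \<le> y"
  shows "inf (a + b) y \<le> inf a y + inf b y"
proof -
  \<comment> \<open>Translation invariance of \<open>inf\<close> expands the sum into the infimum of
    four terms: \<open>a + b\<close>, and three others that lie above \<open>y\<close> by
    positivity.\<close>
  have "inf a y + inf b y = inf (inf (a + b) (y + b)) (inf (a + y) (y + y))"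
    by (simp add: add_inf_distrib_left add_inf_distrib_right)
  moreover have "y \<le> y + b" "y \<le> a + y" "y \<le> y + y"
    using assms by simp_all
  ultimately show ?thesis
    by (auto intro: le_infI2)
qed

text \<open>Truncating at \<open>u\<close> is subadditive on positive elements, so the truncated
  deviation of the sum is dominated by the sum of the two truncated deviations, which is
  order-null.\<close>

lemma uo_convergent_add:
  fixes x y :: "'i \<Rightarrow> 'a::banach_lattice"
  assumes "uo_convergent x l F" and "uo_convergent y m F"
  shows "uo_convergent (\<lambda>i. x i + y i) (l + m) F"
  unfolding uo_convergent_def
proof (intro allI impI)
  fix u :: 'a assume u: "0 \<le> u"
  have "order_convergent (\<lambda>i. inf \<bar>x i - l\<bar> u + inf \<bar>y i - m\<bar> u) (0 + 0) F"
    using assms u unfolding uo_convergent_def by (intro order_convergent_add) auto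
  moreover have "\<bar>inf \<bar>x i + y i - (l + m)\<bar> u\<bar> \<le> \<bar>inf \<bar>x i - l\<bar> u + inf \<bar>y i - m\<bar> u\<bar>" for i
  proof -
    have "inf \<bar>x i + y i - (l + m)\<bar> u \<le> inf (\<bar>x i - l\<bar> + \<bar>y i - m\<bar>) u"
      by (intro inf_mono abs_diff_triangle_ineq order_refl)
    also have "\<dots> \<le> inf \<bar>x i - l\<bar> u + inf \<bar>y i - m\<bar> u"
      using u by (intro inf_add_le) auto
    finally show ?thesis using u by simp
  qed
  ultimately show "order_convergent (\<lambda>i. inf \<bar>x i + y i - (l + m)\<bar> u) 0 F"
    by (auto intro: order_convergent_0_le)
qed

lemma weakly_null_scaleR: "weakly_null x \<Longrightarrow> weakly_null (\<lambda>n. c *\<^sub>R x n)"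
  unfolding weakly_null_def by (auto simp: blinfun.scaleR_right intro: tendsto_mult_right_zero)

theorem proposition4p6:
  fixes T :: "'a::banach_lattice \<Rightarrow>\<^sub>L 'a"
  assumes "uo_demi_Dunford_Pettis T"
    and "sigma_weak_uo_continuous T"
  shows "\<forall>\<alpha>::real. uo_demi_Dunford_Pettis (\<alpha> *\<^sub>R T)"
  unfolding uo_demi_Dunford_Pettis_def
proof (intro allI impI)
  fix \<alpha> :: real and x :: "nat \<Rightarrow> 'a"
  assume x: "weakly_null x"
    and uo: "uo_convergent (\<lambda>n. x n - (\<alpha> *\<^sub>R T) (x n)) 0 sequentially"
  \<comment> \<open>The factor \<alpha> - 1 is what must be added to -\<alpha> to leave -1 in front
    of \<open>T (x n)\<close>. Placing it inside the argument of \<open>T\<close> lets continuity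
    absorb it, so no scaling rule for uo-convergence is called for.\<close>
  have "uo_convergent (\<lambda>n. T ((\<alpha> - 1) *\<^sub>R x n)) 0 sequentially"
    using assms(2) weakly_null_scaleR[OF x] unfolding sigma_weak_uo_continuous_def by blast
  from uo_convergent_add[OF uo this]
  have "uo_convergent (\<lambda>n. x n - T (x n)) 0 sequentially"
    by (simp add: blinfun.scaleR_left blinfun.scaleR_right scaleR_diff_left blinfun.diff_right)
  with assms(1) x show "(\<lambda>n. norm (x n)) \<longlonglongrightarrow> 0"
    unfolding uo_demi_Dunford_Pettis_def by blast
qed

end
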